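(* Let $A\in\mathbb{R}^{m\times n}$, $b\in\mathbb{R}^m$, and let $f:\mathbb{R}^n\to\mathbb{R}$ be $L$-smooth on $[0,1]^n$. For $y,z\in\mathbb{R}$ consider the problems - $(B)$: $\min\{f(x): Ax=b,\ x\in\{0,1\}^n\}$; - $(B^1_y)$: $\min\{f(x)+y\|Ax-b\|^2: x\in\{0,1\}^n\}$; - $(B^2_z)$: $\min\{f(x)+z\sum_{i=1}^n x_i(1-x_i): Ax=b,\ x\in[0,1]^n\}$; - $(B^3_{yz})$: $\min\{f(x)+y\|Ax-b\|^2+z\sum_{i=1}^n x_i(1-x_i): x\in[0,1]^n\}$. Assume that $(B)$ is feasible. Then there exist $y'\in\mathbb{R}$ and $z'\in\mathbb{R}$ such that for all $y>y'$ and all $z>z'$, the problems $(B)$, $(B^1_y)$, $(B^2_z)$ and $(B^3_{yz})$ are all equivalent to each other; that is, the optimal solutions of all these problems coincide.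
   Context: A function $f:\mathbb{R}^n\to\mathbb{R}$ is $L$-smooth on a set $S$ if it is continuously differentiable and $\|\nabla f(x)-\nabla f(y)\|\le L\|x-y\|$ for all $x,y\in S$. $\|\cdot\|$ is the Euclidean norm. Two of these problems are equivalent if their optimal values coincide and their sets of optimal solutions coincide. *)

theory Defs
  imports "HOL-Analysis.Analysis"
begin

definition smooth_on :: "real \<Rightarrow> ('a::real_inner \<Rightarrow> real) \<Rightarrow> 'a set \<Rightarrow> bool" where
  "smooth_on L f S \<longleftrightarrow>
     (\<exists>grad. (\<forall>x. GDERIV f x :> grad x) \<and> continuous_on UNIV grad \<and>
        (\<forall>x\<in>S. \<forall>y\<in>S. norm (grad x - grad y) \<le> L * norm (x - y)))"

datatype 'a problem = Minimize (objective: "'a \<Rightarrow> real") (feasible_set: "'a set")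

text \<open>The optimal value is an extended real, so that it is \<open>\<infinity>\<close> for infeasible and \<open>-\<infinity>\<close> for
  unbounded problems.\<close>

definition optimal_value :: "'a problem \<Rightarrow> ereal" where
  "optimal_value P = (INF x\<in>feasible_set P. ereal (objective P x))"

definition optimal_solutions :: "'a problem \<Rightarrow> 'a set" where
  "optimal_solutions P = {x. is_arg_min (objective P) (\<lambda>x. x \<in> feasible_set P) x}"

definition equivalent :: "'a problem \<Rightarrow> 'a problem \<Rightarrow> bool" where
  "equivalent P Q \<longleftrightarrow>
     optimal_value P = optimal_value Q \<and> optimal_solutions P = optimal_solutions Q"

definition binary_points :: "(real ^ 'n) set" where
  "binary_points = {x. \<forall>i. x $ i \<in> {0, 1}}"

text \<open>In \<^typ>\<open>real ^ 'n\<close> the constant \<open>1\<close> is the all-ones vector.\<close>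

abbreviation unit_cube :: "(real ^ 'n) set" where
  "unit_cube \<equiv> cbox 0 1"

definition problem_B ::
    "real ^ 'n ^ 'm \<Rightarrow> real ^ 'm \<Rightarrow> (real ^ 'n \<Rightarrow> real) \<Rightarrow> (real ^ 'n) problem" where
  "problem_B A b f = Minimize f {x \<in> binary_points. A *v x = b}"

definition problem_B1 ::
    "real ^ 'n ^ 'm \<Rightarrow> real ^ 'm \<Rightarrow> (real ^ 'n \<Rightarrow> real) \<Rightarrow> real \<Rightarrow> (real ^ 'n) problem" where
  "problem_B1 A b f y = Minimize (\<lambda>x. f x + y * (norm (A *v x - b))\<^sup>2) binary_points"

definition problem_B2 ::
    "real ^ 'n ^ 'm \<Rightarrow> real ^ 'm \<Rightarrow> (real ^ 'n \<Rightarrow> real) \<Rightarrow> real \<Rightarrow> (real ^ 'n) problem" where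
  "problem_B2 A b f z =
     Minimize (\<lambda>x. f x + z * (\<Sum>i\<in>UNIV. x $ i * (1 - x $ i))) {x \<in> unit_cube. A *v x = b}"

definition problem_B3 ::
    "real ^ 'n ^ 'm \<Rightarrow> real ^ 'm \<Rightarrow> (real ^ 'n \<Rightarrow> real) \<Rightarrow> real \<Rightarrow> real \<Rightarrow> (real ^ 'n) problem" where
  "problem_B3 A b f y z =
     Minimize (\<lambda>x. f x + y * (norm (A *v x - b))\<^sup>2 + z * (\<Sum>i\<in>UNIV. x $ i * (1 - x $ i)))
       unit_cube"

end

theory Submission
  imports Defs
begin

text \<open>
  Let \<open>r\<close> be the binary point obtained by rounding \<open>x\<close> in the cube. Since
  \<open>t (1 - t) \<ge> min t (1 - t) / 2\<close> on \<open>[0, 1]\<close>, the concave penalty of \<open>x\<close> is at least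
  \<open>\<parallel>x - r\<parallel> / 2\<close>. If \<open>A r = b\<close>, this dominates the Lipschitz loss \<open>f r - f x\<close> once \<open>z\<close> is large.
  Otherwise \<open>\<parallel>A r - b\<parallel>\<close> is at least some \<open>\<delta> > 0\<close> depending only on \<open>A\<close> and \<open>b\<close>; either \<open>x\<close> is so
  near to \<open>r\<close> that \<open>\<parallel>A x - b\<parallel> \<ge> \<delta> / 2\<close>, and a large \<open>y\<close> suffices, or \<open>x\<close> is far from \<open>r\<close>,
  and a large \<open>z\<close> suffices. The thresholds for \<open>y\<close> and \<open>z\<close> do not depend on each other.
\<close>

text \<open>The gradient is continuous, hence bounded on the compact \<open>K\<close>; the mean
  value inequality on the convex \<open>K\<close> turns this bound into a Lipschitz
  constant.\<close>

lemma smooth_on_imp_lipschitz: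
  fixes f :: "'a::euclidean_space \<Rightarrow> real"
  assumes "smooth_on L f S" and "compact K" "convex K"
  obtains C where "C > 0" "\<And>x y. x \<in> K \<Longrightarrow> y \<in> K \<Longrightarrow> \<bar>f x - f y\<bar> \<le> C * norm (x - y)"
proof -
  obtain grad where der: "\<And>x. GDERIV f x :> grad x" and cont: "continuous_on UNIV grad"
    using assms(1) unfolding smooth_on_def by blast
  have "compact (grad ` K)"
    using assms(2) cont by (intro compact_continuous_image) (auto intro: continuous_on_subset)
  then obtain C where C: "C > 0" "\<And>x. x \<in> K \<Longrightarrow> norm (grad x) \<le> C"
    by (auto dest!: compact_imp_bounded simp: bounded_pos)
  have "norm (f x - f y) \<le> C * norm (x - y)" if "x \<in> K" "y \<in> K" for x y
  proof (rule differentiable_bound[OF \<open>convex K\<close> _ _ that])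
    show "(f has_derivative (\<lambda>h. h \<bullet> grad u)) (at u within K)" for u
      using der[of u] by (simp add: gderiv_def has_derivative_at_withinI)
    show "onorm (\<lambda>h. h \<bullet> grad u) \<le> C" if "u \<in> K" for u
    proof (rule onorm_le)
      fix h :: 'a
      have "norm (h \<bullet> grad u) \<le> norm h * norm (grad u)"
        by (simp add: Cauchy_Schwarz_ineq2)
      also have "\<dots> \<le> C * norm h"
        using mult_left_mono[OF C(2)[OF that] norm_ge_zero[of h]] by (simp add: mult.commute)
      finally show "norm (h \<bullet> grad u) \<le> C * norm h" .
    qed
  qed
  with C(1) that show thesis by simp
qed

text \<open>Used twice: finiteness provides a minimiser among the feasible binary points, and it
  keeps the residuals of the infeasible ones away from zero.\<close>

lemma finite_binary_points: "finite (binary_points :: (real ^ 'n) set)"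
proof -
  have "binary_points \<subseteq> vec_lambda ` {g :: 'n \<Rightarrow> real. range g \<subseteq> {0, 1}}"
  proof
    fix x :: "real ^ 'n"
    assume "x \<in> binary_points"
    then have "range (($) x) \<subseteq> {0, 1}" by (auto simp: binary_points_def)
    then show "x \<in> vec_lambda ` {g :: 'n \<Rightarrow> real. range g \<subseteq> {0, 1}}"
      by (intro image_eqI[of _ _ "($) x"]) auto
  qed
  moreover have "finite {g :: 'n \<Rightarrow> real. range g \<subseteq> {0, 1}}"
    \<comment> \<open>The final \<open>0\<close> is the value prescribed outside the domain, a
      vacuous condition for \<open>UNIV\<close>.\<close>
    using finite_set_of_finite_funs[of "UNIV :: 'n set" "{0, 1 :: real}" 0]
    by (simp add: image_subset_iff)
  ultimately show ?thesis using finite_surj by blast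
qed

lemma binary_points_subset_unit_cube: "binary_points \<subseteq> unit_cube"
proof
  fix x :: "real ^ 'n"
  assume x: "x \<in> binary_points"
  have "0 \<le> x $ i \<and> x $ i \<le> 1" for i
    using x[unfolded binary_points_def, simplified, rule_format, of i] by auto
  then show "x \<in> unit_cube" by (simp add: mem_box_cart)
qed

lemma binary_points_penalty_eq_0:
  assumes "x \<in> binary_points"
  shows "(\<Sum>i\<in>UNIV. x $ i * (1 - x $ i)) = 0"
  using assms by (intro sum.neutral) (auto simp: binary_points_def)

definition round_vec :: "real ^ 'n \<Rightarrow> real ^ 'n" where
  "round_vec x = (\<chi> i. if x $ i \<le> 1 / 2 then 0 else 1)"

lemma round_vec_binary: "round_vec x \<in> binary_points"
  by (simp add: round_vec_def binary_points_def)

text \<open>The larger of \<open>t\<close> and \<open>1 - t\<close> is at least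
  \<open>1 / 2\<close>, so twice their product dominates the smaller, which is the rounding error of
  the coordinate. Being linear in the distance, the bound lets a finite \<open>z\<close> outweigh a
  Lipschitz loss.\<close>

lemma norm_diff_round_vec_le_penalty:
  assumes "x \<in> unit_cube"
  shows "norm (x - round_vec x) \<le> 2 * (\<Sum>i\<in>UNIV. x $ i * (1 - x $ i))"
proof -
  have "\<bar>(x - round_vec x) $ i\<bar> \<le> 2 * (x $ i * (1 - x $ i))" for i
  proof -
    have b: "0 \<le> x $ i" "x $ i \<le> 1" using assms by (auto simp: mem_box_cart)
    show ?thesis
    proof (cases "x $ i \<le> 1 / 2")
      case True
      then have "x $ i * 1 \<le> x $ i * (2 * (1 - x $ i))"
        using b by (intro mult_left_mono) auto
      with True b show ?thesis by (simp add: round_vec_def algebra_simps)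
    next
      case False
      then have "(1 - x $ i) * 1 \<le> (1 - x $ i) * (2 * x $ i)"
        using b by (intro mult_left_mono) auto
      with False b show ?thesis by (simp add: round_vec_def algebra_simps)
    qed
  qed
  then have "(\<Sum>i\<in>UNIV. \<bar>(x - round_vec x) $ i\<bar>) \<le> (\<Sum>i\<in>UNIV. 2 * (x $ i * (1 - x $ i)))"
    by (intro sum_mono)
  with norm_le_l1_cart[of "x - round_vec x"] show ?thesis by (simp add: sum_distrib_left)
qed

text \<open>One strict inequality on the cube serves all three relaxations: the \<open>z\<close>
  term vanishes at binary points and the \<open>y\<close> term where \<open>A *v x = b\<close>.
  Strictness rules out spurious minimisers.\<close>

lemma exact_penalty:
  fixes A :: "real ^ 'n ^ 'm" and f :: "real ^ 'n \<Rightarrow> real"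
  assumes "C > 0"
    and lip: "\<And>x y. x \<in> unit_cube \<Longrightarrow> y \<in> unit_cube \<Longrightarrow> \<bar>f x - f y\<bar> \<le> C * norm (x - y)"
    and m: "\<And>x. x \<in> binary_points \<Longrightarrow> A *v x = b \<Longrightarrow> m \<le> f x"
  shows "\<exists>y' z'. \<forall>y > y'. \<forall>z > z'. \<forall>x \<in> unit_cube. x \<in> binary_points \<and> A *v x = b \<or>
    m < f x + y * (norm (A *v x - b))\<^sup>2 + z * (\<Sum>i\<in>UNIV. x $ i * (1 - x $ i))"
proof -
  have "continuous_on unit_cube f"
    using lip \<open>C > 0\<close>
    by (intro lipschitz_on_continuous_on[of C] lipschitz_onI) (auto simp: dist_norm)
  then have "compact (f ` unit_cube)"
    by (intro compact_continuous_image) auto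
  then obtain B where B: "B > 0" "\<And>x. x \<in> unit_cube \<Longrightarrow> \<bar>f x\<bar> \<le> B"
    by (auto dest!: compact_imp_bounded simp: bounded_pos)
  \<comment> \<open>\<open>f\<close> falls below \<open>m\<close> by at most \<open>D\<close> on the
    cube, so any penalty exceeding \<open>D\<close> is enough.\<close>
  define D where "D = \<bar>m\<bar> + B"
  have D: "D > 0" "\<And>x. x \<in> unit_cube \<Longrightarrow> m - D \<le> f x"
    using B by (force simp: D_def abs_le_iff)+
  obtain K where K: "K > 0" "\<And>v. norm (A *v v) \<le> K * norm v"
    using linear_bounded_pos[OF matrix_vector_mul_linear[of A]] by blast
  obtain \<delta> where \<delta>: "\<delta> > 0"
    "\<And>r. r \<in> binary_points \<Longrightarrow> A *v r \<noteq> b \<Longrightarrow> \<delta> \<le> norm (A *v r - b)"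
  proof -
    define N where "N = (\<lambda>r. norm (A *v r - b)) ` {r \<in> binary_points. A *v r \<noteq> b}"
    \<comment> \<open>The extra \<open>1\<close> keeps \<open>Min\<close> meaningful when every
      binary point satisfies the constraint.\<close>
    have "finite (insert 1 N)"
      using finite_binary_points unfolding N_def
      by (intro finite.insertI finite_imageI) (rule finite_subset, auto)
    then show thesis
      by (intro that[of "Min (insert 1 N)"]) (auto simp: N_def)
  qed
  show ?thesis
  proof (intro exI allI impI ballI)
    fix y z :: real and x :: "real ^ 'n"
    let ?p = "\<Sum>i\<in>UNIV. x $ i * (1 - x $ i)"
    let ?q = "(norm (A *v x - b))\<^sup>2"
    \<comment> \<open>These assumptions fix the witnesses left open by \<open>exI\<close>. The three
      constants answer, in order, the bounds \<open>?q \<ge> (\<delta> / 2)\<^sup>2\<close>,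
      \<open>2 * ?p \<ge> norm (x - r)\<close> and \<open>?p \<ge> \<delta> / (4 * K)\<close> of the
      cases below.\<close>
    assume y: "y > 4 * D / \<delta>\<^sup>2" and z: "z > max (2 * C) (4 * K * D / \<delta>)" and x: "x \<in> unit_cube"
    define r where "r = round_vec x"
    have r: "r \<in> binary_points" by (simp add: r_def round_vec_binary)
    have p: "norm (x - r) \<le> 2 * ?p"
      using norm_diff_round_vec_le_penalty[OF x] by (simp add: r_def)
    then have p0: "?p \<ge> 0" using norm_ge_zero[of "x - r"] by linarith
    have y0: "y > 0"
      using y D(1) \<delta>(1) by (smt (verit) divide_pos_pos zero_less_power)
    have z0: "z > 0" using z \<open>C > 0\<close> by simp
    have yq: "y * ?q \<ge> 0" using y0 by simp
    have zp: "z * ?p \<ge> 0" using z0 p0 by simp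
    show "x \<in> binary_points \<and> A *v x = b \<or> m < f x + y * ?q + z * ?p"
    proof (cases "A *v r = b")
      case True
      show ?thesis
      proof (cases "x = r")
        case True
        with \<open>A *v r = b\<close> r show ?thesis by simp
      next
        case False
        have "r \<in> unit_cube" using r binary_points_subset_unit_cube by blast
        with lip[OF x] have "\<bar>f x - f r\<bar> \<le> C * norm (x - r)" by blast
        \<comment> \<open>Strict because \<open>x\<close> differs from \<open>r\<close>; half of the
          resulting chain bounds the loss \<open>f r - f x\<close>.\<close>
        moreover have "2 * C * norm (x - r) < z * norm (x - r)"
          using False z by simp
        moreover have "z * norm (x - r) \<le> z * (2 * ?p)"
          using p z0 by (intro mult_left_mono) auto
        ultimately have "f r < f x + z * ?p" by linarith
        moreover have "m \<le> f r" using m r True by blast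
        ultimately show ?thesis using yq by linarith
      qed
    next
      case False
      show ?thesis
      proof (cases "K * norm (x - r) \<le> \<delta> / 2")
        case True
        have "\<delta> \<le> norm (A *v r - b)" using \<delta>(2) r False by blast
        \<comment> \<open>\<open>A *v r - b\<close> is the difference of the two vectors on the
          right, and the second has norm at most \<open>\<delta> / 2\<close>.\<close>
        also have "\<dots> \<le> norm (A *v x - b) + norm (A *v (x - r))"
          using norm_triangle_ineq4[of "A *v x - b" "A *v (x - r)"]
          by (simp add: matrix_vector_mult_diff_distrib)
        finally have "\<delta> / 2 \<le> norm (A *v x - b)" using K(2)[of "x - r"] True by linarith
        then have "(\<delta> / 2)\<^sup>2 \<le> ?q" using \<delta>(1) by (intro power_mono) auto
        then have "y * (\<delta> / 2)\<^sup>2 \<le> y * ?q" using y0 by (intro mult_left_mono) auto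
        moreover have "D < y * (\<delta> / 2)\<^sup>2"
          using y \<delta>(1) by (simp add: field_simps)
        ultimately show ?thesis using D(2)[OF x] zp by linarith
      next
        case False
        have "K * norm (x - r) \<le> K * (2 * ?p)" using p K(1) by (intro mult_left_mono) auto
        with False have "\<delta> \<le> ?p * (4 * K)" by (simp add: mult.commute mult.left_commute)
        then have "\<delta> / (4 * K) \<le> ?p" using K(1) by (simp add: pos_divide_le_eq)
        then have "z * (\<delta> / (4 * K)) \<le> z * ?p" using z0 by (intro mult_left_mono) auto
        moreover have "D < z * (\<delta> / (4 * K))"
          using z \<delta>(1) K(1) by (simp add: field_simps)
        ultimately show ?thesis using D(2)[OF x] yq by linarith
      qed
    qed
  qed
qed

lemma equivalent_sym: "equivalent P Q \<Longrightarrow> equivalent Q P"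
  by (simp add: equivalent_def)

lemma equivalent_trans: "equivalent P Q \<Longrightarrow> equivalent Q R \<Longrightarrow> equivalent P R"
  by (simp add: equivalent_def)

lemma optimal_value_eq_minimum:
  assumes "x \<in> optimal_solutions P"
  shows "optimal_value P = ereal (objective P x)"
proof -
  have "x \<in> feasible_set P" "\<And>u. u \<in> feasible_set P \<Longrightarrow> objective P x \<le> objective P u"
    using assms by (auto simp: optimal_solutions_def is_arg_min_linorder)
  then show ?thesis
    unfolding optimal_value_def by (intro antisym INF_lower INF_greatest) auto
qed

text \<open>Both solution sets are level sets for the value \<open>f x0\<close>, of \<open>f\<close>
  in \<open>F\<close> and of \<open>h\<close> in \<open>S\<close>. They agree because
  \<open>h\<close> equals \<open>f\<close> on \<open>F\<close> and stays strictly above that value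
  elsewhere.\<close>

lemma equivalent_relaxation:
  assumes x0: "x0 \<in> optimal_solutions (Minimize f F)"
    and sub: "F \<subseteq> S" and eq: "\<And>x. x \<in> F \<Longrightarrow> h x = f x"
    and gt: "\<And>x. x \<in> S \<Longrightarrow> x \<notin> F \<Longrightarrow> f x0 < h x"
  shows "equivalent (Minimize f F) (Minimize h S)"
proof -
  have x0': "x0 \<in> F" "\<And>u. u \<in> F \<Longrightarrow> f x0 \<le> f u"
    using x0 by (auto simp: optimal_solutions_def is_arg_min_linorder)
  have le: "f x0 \<le> h u" if "u \<in> S" for u
  proof (cases "u \<in> F")
    case True
    then show ?thesis using x0'(2)[of u] eq[of u] by simp
  next
    case False
    then show ?thesis using gt[OF that] by simp
  qed
  have "x \<in> optimal_solutions (Minimize f F) \<longleftrightarrow> x \<in> F \<and> f x = f x0" for x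
    using x0' unfolding optimal_solutions_def is_arg_min_linorder
    by simp (metis order_antisym)
  moreover have "x \<in> optimal_solutions (Minimize h S) \<longleftrightarrow> x \<in> S \<and> h x = f x0" for x
    using x0'(1) le sub eq[of x0] unfolding optimal_solutions_def is_arg_min_linorder
    by simp (metis order_antisym subsetD)
  moreover have "x \<in> F \<and> f x = f x0 \<longleftrightarrow> x \<in> S \<and> h x = f x0" for x
    using sub eq[of x] gt[of x] by (cases "x \<in> F") auto
  ultimately have sol: "optimal_solutions (Minimize f F) = optimal_solutions (Minimize h S)"
    by blast
  have "optimal_value (Minimize f F) = ereal (f x0)"
    using optimal_value_eq_minimum[OF x0] by simp
  moreover have "optimal_value (Minimize h S) = ereal (h x0)"
    using optimal_value_eq_minimum[OF x0[unfolded sol]] by simp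
  ultimately show ?thesis
    using sol eq[OF x0'(1)] by (simp add: equivalent_def)
qed

theorem theorem3:
  fixes A :: "real ^ 'n ^ 'm" and b :: "real ^ 'm" and f :: "real ^ 'n \<Rightarrow> real" and L :: real
  assumes "smooth_on L f unit_cube"
    and "feasible_set (problem_B A b f) \<noteq> {}"
  shows "\<exists>y' z' :: real. \<forall>y > y'. \<forall>z > z'.
    (\<forall>P \<in> {problem_B A b f, problem_B1 A b f y, problem_B2 A b f z, problem_B3 A b f y z}.
     \<forall>Q \<in> {problem_B A b f, problem_B1 A b f y, problem_B2 A b f z, problem_B3 A b f y z}.
       equivalent P Q)"
proof -
  define F where "F = {x \<in> binary_points. A *v x = b}"
  have F: "finite F" "F \<noteq> {}"
    using assms(2) finite_binary_points by (auto simp: F_def problem_B_def)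
  \<comment> \<open>The value \<open>f x0\<close> plays the role of \<open>m\<close> in
    \<open>exact_penalty\<close>.\<close>
  then obtain x0 where x0: "x0 \<in> F" "\<And>x. x \<in> F \<Longrightarrow> f x0 \<le> f x"
    using arg_min_if_finite(1)[OF F] arg_min_least[OF F] by metis
  then have opt: "x0 \<in> optimal_solutions (Minimize f F)"
    by (simp add: optimal_solutions_def is_arg_min_linorder)
  obtain C where C: "C > 0"
    "\<And>x y. x \<in> unit_cube \<Longrightarrow> y \<in> unit_cube \<Longrightarrow> \<bar>f x - f y\<bar> \<le> C * norm (x - y)"
    using smooth_on_imp_lipschitz[OF assms(1) compact_cbox convex_box(1)] by blast
  have "\<exists>y' z'. \<forall>y > y'. \<forall>z > z'. \<forall>x \<in> unit_cube. x \<in> binary_points \<and> A *v x = b \<or>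
    f x0 < f x + y * (norm (A *v x - b))\<^sup>2 + z * (\<Sum>i\<in>UNIV. x $ i * (1 - x $ i))"
    using x0(2) by (intro exact_penalty[OF C]) (auto simp: F_def)
  then obtain y' z' where gt: "\<And>y z x. y > y' \<Longrightarrow> z > z' \<Longrightarrow> x \<in> unit_cube \<Longrightarrow> x \<notin> F \<Longrightarrow>
    f x0 < f x + y * (norm (A *v x - b))\<^sup>2 + z * (\<Sum>i\<in>UNIV. x $ i * (1 - x $ i))"
    unfolding F_def by blast
  show ?thesis
  proof (intro exI allI impI)
    fix y z
    assume yz: "y > y'" "z > z'"
    note gt = gt[OF yz]
    let ?PS = "{problem_B A b f, problem_B1 A b f y, problem_B2 A b f z, problem_B3 A b f y z}"
    have "equivalent (Minimize f F) (problem_B A b f)"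
      by (simp add: equivalent_def problem_B_def F_def)
    moreover have "equivalent (Minimize f F) (problem_B1 A b f y)"
      unfolding problem_B1_def
    proof (rule equivalent_relaxation[OF opt])
      show "f x0 < f x + y * (norm (A *v x - b))\<^sup>2" if "x \<in> binary_points" "x \<notin> F" for x
        using gt[of x] that binary_points_subset_unit_cube
        by (auto simp: binary_points_penalty_eq_0)
    qed (auto simp: F_def)
    moreover have "equivalent (Minimize f F) (problem_B2 A b f z)"
      unfolding problem_B2_def
    proof (rule equivalent_relaxation[OF opt])
      show "f x0 < f x + z * (\<Sum>i\<in>UNIV. x $ i * (1 - x $ i))"
        if "x \<in> {x \<in> unit_cube. A *v x = b}" "x \<notin> F" for x
        using gt[of x] that by simp
    qed (use binary_points_subset_unit_cube in \<open>auto simp: F_def binary_points_penalty_eq_0\<close>)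
    moreover have "equivalent (Minimize f F) (problem_B3 A b f y z)"
      unfolding problem_B3_def using gt binary_points_subset_unit_cube
      by (intro equivalent_relaxation[OF opt]) (auto simp: F_def binary_points_penalty_eq_0)
    \<comment> \<open>With \<open>Minimize f F\<close> as a common hub, symmetry and transitivity
      yield all pairs.\<close>
    ultimately have "\<forall>P \<in> ?PS. equivalent (Minimize f F) P" by blast
    then show "\<forall>P \<in> ?PS. \<forall>Q \<in> ?PS. equivalent P Q"
      by (blast intro: equivalent_sym equivalent_trans)
  qed
qed

end
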